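(* For every integer $n\ge0$, let $nov(n)$ (resp. $ov(n)$) be the sum, over all overpartitions of $n$, of the non-overlined (resp. overlined) parts. Then for all $n\ge 0$, $$(n+2)\,nov(n)\equiv (n^2+4n+3)\,ov(n)\pmod 5$$ and $$(n^2+1)\,nov(n)\equiv (4n^3-n^2-1)\,ov(n)\pmod 7.$$
   Context: An overpartition of $n$ is a partition of $n$ in which the first occurrence of each distinct part may be overlined. The sum of non-overlined parts counts each non-overlined part with multiplicity. *)

theory Defs
  imports Main "HOL-Library.Multiset" "HOL-Number_Theory.Cong"
begin

text \<open>An overpartition is represented as a multiset of parts (k, b), where k > 0 is
  the part size and b = True means the part is overlined. Since only the first
  occurrence of each distinct part may be overlined, each size k occurs overlined
  at most once.\<close>

definition overpartitions :: "nat \<Rightarrow> (nat \<times> bool) multiset set" where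
  "overpartitions n = {M. (\<forall>p \<in># M. fst p > 0) \<and> (\<forall>k. count M (k, True) \<le> 1)
                         \<and> sum_mset (image_mset fst M) = n}"

definition nov :: "nat \<Rightarrow> nat" where
  "nov n = (\<Sum>M \<in> overpartitions n. sum_mset (image_mset fst (filter_mset (\<lambda>p. \<not> snd p) M)))"

definition ov :: "nat \<Rightarrow> nat" where
  "ov n = (\<Sum>M \<in> overpartitions n. sum_mset (image_mset fst (filter_mset (\<lambda>p. snd p) M)))"

end

theory Submission
  imports Defs "HOL-Computational_Algebra.Formal_Power_Series"
begin

text \<open>Let \<open>P\<close> be the generating function of overpartitions and \<open>D = q d/dq\<close>. The generating
  functions of \<open>nov\<close> and \<open>ov\<close> are \<open>P U\<close> and \<open>P B\<close>, where \<open>U\<close> and \<open>B\<close> sum all, respectively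
  all odd, divisors. Put \<open>f = 1 + 24 B\<close> and \<open>e = E\<^sub>2 = 1 - 24 U\<close>. Since \<open>nov + ov\<close> is the
  derivative of \<open>P\<close>, we have \<open>24 D P = P (f - e)\<close>, and the two claims become
  \<open>D\<^sup>2 (P f) + 2 D P = 0\<close> modulo 5 and \<open>D\<^sup>3 (P f) + D P = 0\<close> modulo 7.
  The ring generated by \<open>e\<close>, \<open>f\<close> and \<open>E\<^sub>4\<close> is closed under \<open>D\<close> up to denominators by
  Ramanujan's differential equations and their level 2 analogues, so both claims are polynomial
  identities, once \<open>E\<^sub>4 = 1\<close> modulo 5, and \<open>E\<^sub>6 = 4 f\<^sup>3 - 3 f E\<^sub>4 = 1\<close> and
  \<open>E\<^sub>4\<^sup>2 = E\<^sub>2\<close> modulo 7 are used. The differential equations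
  are convolution identities for divisor sums, and these are all instances of Liouville's
  identity.\<close>

unbundle fps_syntax

section \<open>Liouville's identity\<close>

text \<open>Encodes a divisor \<open>a\<close> of \<open>i\<close> and a divisor \<open>b\<close> of
  \<open>n - i\<close> for \<open>0 < i < n\<close>. The cofactors \<open>x\<close> and
  \<open>y\<close> are kept as coordinates because the bijections behind Liouville's identity mix
  divisors with cofactors.\<close>

definition quads :: "nat \<Rightarrow> (nat \<times> nat \<times> nat \<times> nat) set" where
  "quads n = {(a, b, x, y). a > 0 \<and> b > 0 \<and> x > 0 \<and> y > 0 \<and> a * x + b * y = n}"

lemma finite_quads [simp]: "finite (quads n)"
proof (rule finite_subset)
  show "quads n \<subseteq> {..n} \<times> {..n} \<times> {..n} \<times> {..n}"
  proof
    fix q assume "q \<in> quads n"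
    then obtain a b x y where q: "q = (a, b, x, y)" "a > 0" "b > 0" "x > 0" "y > 0"
      "a * x + b * y = n" by (auto simp: quads_def)
    have "a \<le> a * x" "x \<le> a * x" "b \<le> b * y" "y \<le> b * y" using q by auto
    then have "a \<le> n" "b \<le> n" "x \<le> n" "y \<le> n" using q(6) by linarith+
    then show "q \<in> {..n} \<times> {..n} \<times> {..n} \<times> {..n}" using q(1) by simp
  qed
qed simp

text \<open>The guard makes the coefficient at 0 vanish; there every number is a divisor.\<close>

definition divisor_fps :: "(nat \<Rightarrow> int) \<Rightarrow> int fps" where
  "divisor_fps g = Abs_fps (\<lambda>n. if n = 0 then 0 else \<Sum>d | d dvd n. g d)"

lemma divisor_fps_nth: "n > 0 \<Longrightarrow> divisor_fps g $ n = (\<Sum>d | d dvd n. g d)"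
  and divisor_fps_nth_0 [simp]: "divisor_fps g $ 0 = 0"
  by (simp_all add: divisor_fps_def)

text \<open>The end terms \<open>i = 0\<close> and \<open>i = n\<close> of the Cauchy product vanish
  with the coefficient at 0, so every surviving pair of divisors has positive cofactors.\<close>

lemma divisor_fps_mult_nth:
  "(divisor_fps g * divisor_fps h) $ n = (\<Sum>(a, b, x, y) \<in> quads n. g a * h b)"
proof -
  have "(divisor_fps g * divisor_fps h) $ n
      = (\<Sum>i=0..n. \<Sum>(a, b) \<in> {(a, b). 0 < i \<and> i < n \<and> a dvd i \<and> b dvd (n - i)}. g a * h b)"
    unfolding fps_mult_nth
  proof (intro sum.cong refl)
    fix i assume i: "i \<in> {0..n}"
    show "divisor_fps g $ i * divisor_fps h $ (n - i)
       = (\<Sum>(a, b) \<in> {(a, b). 0 < i \<and> i < n \<and> a dvd i \<and> b dvd (n - i)}. g a * h b)"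
    proof (cases "0 < i \<and> i < n")
      case True
      then have "{(a, b). 0 < i \<and> i < n \<and> a dvd i \<and> b dvd (n - i)} = {a. a dvd i} \<times> {b. b dvd (n - i)}"
        by auto
      then show ?thesis using True
        by (simp add: divisor_fps_nth sum_product sum.cartesian_product)
    next
      case False
      then have "i = 0 \<or> n - i = 0" using i by auto
      then have "divisor_fps g $ i * divisor_fps h $ (n - i) = 0" by auto
      moreover have "{(a, b). 0 < i \<and> i < n \<and> a dvd i \<and> b dvd (n - i)} = {}" using False by auto
      ultimately show ?thesis by (simp only: sum.empty)
    qed
  qed
  also have "\<dots> = (\<Sum>(i, a, b) \<in> Sigma {0..n} (\<lambda>i. {(a, b). 0 < i \<and> i < n \<and> a dvd i \<and> b dvd (n - i)}). g a * h b)"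
  proof (subst sum.Sigma)
    show "\<forall>i\<in>{0..n}. finite {(a, b). 0 < i \<and> i < n \<and> a dvd i \<and> b dvd (n - i)}"
    proof
      fix i
      have "{(a, b). 0 < i \<and> i < n \<and> a dvd i \<and> b dvd (n - i)} \<subseteq> {..n} \<times> {..n}"
        by (auto dest!: dvd_imp_le)
      then show "finite {(a, b). 0 < i \<and> i < n \<and> a dvd i \<and> b dvd (n - i)}"
        by (rule finite_subset) simp
    qed
  qed (auto simp: case_prod_unfold)
  also have "\<dots> = (\<Sum>(a, b, x, y) \<in> quads n. g a * h b)"
    by (rule sum.reindex_bij_witness[where
          i = "\<lambda>(a, b, x, y). (a * x, a, b)" and j = "\<lambda>(i, a, b). (a, b, i div a, (n - i) div b)"])
       (auto simp: quads_def dvd_div_eq_0_iff intro!: Nat.gr0I)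
  finally show ?thesis .
qed


lemma sum_quads_split3:
  fixes f :: "nat \<times> nat \<times> nat \<times> nat \<Rightarrow> int" and u v :: "nat \<times> nat \<times> nat \<times> nat \<Rightarrow> nat"
  shows "(\<Sum>q \<in> quads n. f q) = (\<Sum>q \<in> {q \<in> quads n. u q < v q}. f q)
    + (\<Sum>q \<in> {q \<in> quads n. u q = v q}. f q) + (\<Sum>q \<in> {q \<in> quads n. v q < u q}. f q)"
proof -
  have "quads n = {q \<in> quads n. u q < v q} \<union> {q \<in> quads n. u q = v q} \<union> {q \<in> quads n. v q < u q}"
    by auto
  then have "sum f (quads n) = sum f ({q \<in> quads n. u q < v q} \<union> {q \<in> quads n. u q = v q} \<union> {q \<in> quads n. v q < u q})"
    by simp
  also have "\<dots> = (\<Sum>q \<in> {q \<in> quads n. u q < v q}. f q)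
    + (\<Sum>q \<in> {q \<in> quads n. u q = v q}. f q) + (\<Sum>q \<in> {q \<in> quads n. v q < u q}. f q)"
    by (subst sum.union_disjoint; (subst sum.union_disjoint)?) auto
  finally show ?thesis .
qed

text \<open>For \<open>a = b = d\<close> the equation becomes \<open>d * (x + y) = n\<close>, which
  leaves \<open>n div d - 1\<close> choices of \<open>x\<close>.\<close>

lemma sum_quads_diagonal_left:
  fixes f :: "nat \<Rightarrow> int"
  assumes "n > 0"
  shows "(\<Sum>(a, b, x, y) \<in> {(a, b, x, y) \<in> quads n. a = b}. f a)
       = (\<Sum>d | d dvd n. (int (n div d) - 1) * f d)"
proof -
  have "(\<Sum>d | d dvd n. (int (n div d) - 1) * f d) = (\<Sum>d | d dvd n. \<Sum>x = 1..<n div d. f d)"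
  proof (rule sum.cong[OF refl])
    fix d assume "d \<in> {d. d dvd n}"
    then have "n div d > 0" using assms by (auto elim!: dvdE)
    then show "(int (n div d) - 1) * f d = (\<Sum>x = 1..<n div d. f d)" by (simp add: of_nat_diff)
  qed
  also have "\<dots> = (\<Sum>(d, x) \<in> Sigma {d. d dvd n} (\<lambda>d. {1..<n div d}). f d)"
    using assms by (subst sum.Sigma) auto
  also have "\<dots> = (\<Sum>(a, b, x, y) \<in> {(a, b, x, y) \<in> quads n. a = b}. f a)"
    using assms
    by (intro sum.reindex_bij_witness[where
        i = "\<lambda>(a, b, x, y). (a, x)" and j = "\<lambda>(d, x). (d, d, x, n div d - x)"])
       (auto simp: quads_def simp flip: distrib_left add_mult_distrib2 intro!: Nat.gr0I)
  finally show ?thesis ..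
qed

text \<open>For \<open>x = y\<close> the equation becomes \<open>(a + b) * x = n\<close>, so
  \<open>d = a + b\<close> divides \<open>n\<close> and \<open>c = a\<close> runs below
  \<open>d\<close>.\<close>

lemma sum_quads_diagonal_right:
  fixes f :: "nat \<Rightarrow> nat \<Rightarrow> int"
  assumes "n > 0"
  shows "(\<Sum>(a, b, x, y) \<in> {(a, b, x, y) \<in> quads n. x = y}. f a (a + b))
       = (\<Sum>d | d dvd n. \<Sum>c = 1..<d. f c d)"
proof -
  have "(\<Sum>d | d dvd n. \<Sum>c = 1..<d. f c d) = (\<Sum>(d, c) \<in> Sigma {d. d dvd n} (\<lambda>d. {1..<d}). f c d)"
    using assms by (subst sum.Sigma) auto
  also have "\<dots> = (\<Sum>(a, b, x, y) \<in> {(a, b, x, y) \<in> quads n. x = y}. f a (a + b))"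
    using assms
    by (intro sum.reindex_bij_witness[where
        i = "\<lambda>(a, b, x, y). (a + b, a)" and j = "\<lambda>(d, c). (c, d - c, n div d, n div d)"])
       (auto simp: quads_def simp flip: distrib_right add_mult_distrib intro!: Nat.gr0I)
  finally show ?thesis ..
qed

text \<open>Subtracting the smaller of two variables turns both sums below into the sums of
  \<open>F a\<close> over the quadruples with \<open>x < y\<close> and with \<open>b < a\<close>; these two differ only by
  diagonal terms.\<close>

theorem liouville_identity:
  fixes F :: "int \<Rightarrow> int"
  assumes even: "\<And>x. F (- x) = F x" and n: "n > 0"
  shows "(\<Sum>(a, b, x, y) \<in> quads n. F (int a - int b) - F (int a + int b)) =
    (\<Sum>d | d dvd n. (int (n div d) - 1) * (F 0 + 2 * F (int d)) - (int d - 1) * F (int d)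
        - 2 * (\<Sum>c = 1..<d. F (int c)))"
proof -
  let ?Q = "quads n"
  define T1 where "T1 = (\<Sum>(a, b, x, y) \<in> {(a, b, x, y) \<in> ?Q. x < y}. F (int a))"
  define T2 where "T2 = (\<Sum>(a, b, x, y) \<in> {(a, b, x, y) \<in> ?Q. b < a}. F (int a))"
  have split_ab: "(\<Sum>(a, b, x, y) \<in> ?Q. f a b) =
      (\<Sum>(a, b, x, y) \<in> {(a, b, x, y) \<in> ?Q. a < b}. f a b)
    + (\<Sum>(a, b, x, y) \<in> {(a, b, x, y) \<in> ?Q. a = b}. f a b)
    + (\<Sum>(a, b, x, y) \<in> {(a, b, x, y) \<in> ?Q. b < a}. f a b)" for f :: "nat \<Rightarrow> nat \<Rightarrow> int"
    using sum_quads_split3[of "\<lambda>(a, b, x, y). f a b" n "\<lambda>(a, b, x, y). a" "\<lambda>(a, b, x, y). b"]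
    by (simp add: case_prod_unfold)
  have split_xy: "(\<Sum>(a, b, x, y) \<in> ?Q. f a b) =
      (\<Sum>(a, b, x, y) \<in> {(a, b, x, y) \<in> ?Q. x < y}. f a b)
    + (\<Sum>(a, b, x, y) \<in> {(a, b, x, y) \<in> ?Q. x = y}. f a b)
    + (\<Sum>(a, b, x, y) \<in> {(a, b, x, y) \<in> ?Q. y < x}. f a b)" for f :: "nat \<Rightarrow> nat \<Rightarrow> int"
    using sum_quads_split3[of "\<lambda>(a, b, x, y). f a b" n "\<lambda>(a, b, x, y). x" "\<lambda>(a, b, x, y). y"]
    by (simp add: case_prod_unfold)
  have swap: "(\<Sum>(a, b, x, y) \<in> {(a, b, x, y) \<in> ?Q. a < b}. f a b)
      = (\<Sum>(a, b, x, y) \<in> {(a, b, x, y) \<in> ?Q. b < a}. f b a)"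
    "(\<Sum>(a, b, x, y) \<in> {(a, b, x, y) \<in> ?Q. x < y}. f a b)
      = (\<Sum>(a, b, x, y) \<in> {(a, b, x, y) \<in> ?Q. y < x}. f b a)"
    for f :: "nat \<Rightarrow> nat \<Rightarrow> int"
    by (rule sum.reindex_bij_witness[where
      i = "\<lambda>(a, b, x, y). (b, a, y, x)" and j = "\<lambda>(a, b, x, y). (b, a, y, x)"],
        auto simp: quads_def)+

  \<comment> \<open>The next three bijections rest on rewriting \<open>a x + b y\<close> as
    \<open>(a - b) x + b (x + y)\<close>, as \<open>(a + b) y + a (x - y)\<close> and as
    \<open>a (x - y) + (a + b) y\<close>.\<close>
  have minus: "(\<Sum>(a, b, x, y) \<in> {(a, b, x, y) \<in> ?Q. b < a}. F (int a - int b)) = T1"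
    unfolding T1_def
    by (rule sum.reindex_bij_witness[where
      i = "\<lambda>(a, b, x, y). (a + b, b, x, y - x)" and j = "\<lambda>(a, b, x, y). (a - b, b, x, x + y)"])
      (auto simp: quads_def algebra_simps dest!: less_imp_Suc_add)
  have plus: "(\<Sum>(a, b, x, y) \<in> {(a, b, x, y) \<in> ?Q. y < x}. F (int a + int b)) = T2"
    unfolding T2_def
    by (rule sum.reindex_bij_witness[where
      i = "\<lambda>(a, b, x, y). (b, a - b, x + y, x)" and j = "\<lambda>(a, b, x, y). (a + b, a, y, x - y)"])
      (auto simp: quads_def algebra_simps dest!: less_imp_Suc_add)
  have cross: "(\<Sum>(a, b, x, y) \<in> {(a, b, x, y) \<in> ?Q. y < x}. F (int a))
      = (\<Sum>(a, b, x, y) \<in> {(a, b, x, y) \<in> ?Q. a < b}. F (int a))"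
    by (rule sum.reindex_bij_witness[where
      i = "\<lambda>(a, b, x, y). (a, b - a, x + y, y)" and j = "\<lambda>(a, b, x, y). (a, a + b, x - y, y)"])
      (auto simp: quads_def algebra_simps dest!: less_imp_Suc_add)

  have "(\<Sum>(a, b, x, y) \<in> ?Q. F (int a - int b)) =
      2 * T1 + (\<Sum>d | d dvd n. (int (n div d) - 1) * F 0)"
  proof -
    have "(\<Sum>(a, b, x, y) \<in> {(a, b, x, y) \<in> ?Q. b < a}. F (int b - int a)) = T1"
      using even[of "int _ - int _"] by (simp add: minus)
    moreover have "(\<Sum>(a, b, x, y) \<in> {(a, b, x, y) \<in> ?Q. a = b}. F (int a - int b))
        = (\<Sum>(a, b, x, y) \<in> {(a, b, x, y) \<in> ?Q. a = b}. F 0)"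
      by (intro sum.cong) auto
    ultimately show ?thesis
      using split_ab[of "\<lambda>a b. F (int a - int b)"] swap(1)[of "\<lambda>a b. F (int a - int b)"]
        sum_quads_diagonal_left[OF n, of "\<lambda>_. F 0"] by (simp add: minus)
  qed
  moreover have "(\<Sum>(a, b, x, y) \<in> ?Q. F (int a + int b)) =
      2 * T2 + (\<Sum>d | d dvd n. (int d - 1) * F (int d))"
  proof -
    have "(\<Sum>(a, b, x, y) \<in> {(a, b, x, y) \<in> ?Q. y < x}. F (int b + int a)) = T2"
      using plus by (simp add: add.commute)
    moreover have "(\<Sum>d | d dvd n. \<Sum>c = 1..<d. F (int d)) = (\<Sum>d | d dvd n. (int d - 1) * F (int d))"
    proof (rule sum.cong[OF refl])
      fix d assume "d \<in> {d. d dvd n}"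
      then have "d > 0" using n by (auto intro: Nat.gr0I)
      then show "(\<Sum>c = 1..<d. F (int d)) = (int d - 1) * F (int d)" by (simp add: of_nat_diff)
    qed
    ultimately show ?thesis
      using split_xy[of "\<lambda>a b. F (int a + int b)"] swap(2)[of "\<lambda>a b. F (int a + int b)"]
        sum_quads_diagonal_right[OF n, of "\<lambda>_ d. F (int d)"] by (simp add: plus)
  qed
  \<comment> \<open>The sum of \<open>F a\<close> over all quadruples is split once by comparing
    \<open>a\<close> with \<open>b\<close> and once by comparing \<open>x\<close> with
    \<open>y\<close>; \<open>cross\<close> cancels the parts other than \<open>T1\<close>,
    \<open>T2\<close> and the diagonals.\<close>
  moreover have "T1 + (\<Sum>d | d dvd n. \<Sum>c = 1..<d. F (int c))
      = T2 + (\<Sum>d | d dvd n. (int (n div d) - 1) * F (int d))"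
    using split_ab[of "\<lambda>a b. F (int a)"] split_xy[of "\<lambda>a b. F (int a)"] cross
      sum_quads_diagonal_right[OF n, of "\<lambda>c _. F (int c)"]
      sum_quads_diagonal_left[OF n, of "\<lambda>d. F (int d)"]
    by (simp add: T1_def T2_def)
  moreover have "(\<Sum>d | d dvd n. (int (n div d) - 1) * (F 0 + 2 * F (int d)) - (int d - 1) * F (int d)
        - 2 * (\<Sum>c = 1..<d. F (int c))) =
      (\<Sum>d | d dvd n. (int (n div d) - 1) * F 0) + 2 * (\<Sum>d | d dvd n. (int (n div d) - 1) * F (int d))
      - (\<Sum>d | d dvd n. (int d - 1) * F (int d)) - 2 * (\<Sum>d | d dvd n. \<Sum>c = 1..<d. F (int c))"
    by (simp only: sum_distrib_left[of 2] flip: sum.distrib sum_subtractf)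
       (intro sum.cong refl, simp add: algebra_simps sum_distrib_left)
  moreover have "(\<Sum>(a, b, x, y) \<in> ?Q. F (int a - int b) - F (int a + int b)) =
      (\<Sum>(a, b, x, y) \<in> ?Q. F (int a - int b)) - (\<Sum>(a, b, x, y) \<in> ?Q. F (int a + int b))"
    by (simp add: case_prod_unfold sum_subtractf)
  ultimately show ?thesis by linarith
qed

section \<open>Convolutions of divisor sums\<close>

definition euler_deriv :: "int fps \<Rightarrow> int fps" where
  "euler_deriv F = fps_X * fps_deriv F"

lemma euler_deriv_nth: "euler_deriv F $ n = int n * F $ n"
  by (simp add: euler_deriv_def fps_mult_fps_X_deriv_shift)

lemma euler_deriv_add: "euler_deriv (F + G) = euler_deriv F + euler_deriv G"
  and euler_deriv_diff: "euler_deriv (F - G) = euler_deriv F - euler_deriv G"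
  and euler_deriv_mult: "euler_deriv (F * G) = euler_deriv F * G + F * euler_deriv G"
  and euler_deriv_numeral: "euler_deriv (numeral k) = 0"
  and euler_deriv_one: "euler_deriv 1 = 0"
  by (simp_all add: euler_deriv_def algebra_simps)

lemmas euler_deriv_simps = euler_deriv_add euler_deriv_diff euler_deriv_mult
  euler_deriv_numeral euler_deriv_one

lemma numeral_mult_fps_nth: "(numeral k * F) $ n = numeral k * F $ n" for F :: "int fps"
  by (simp add: numeral_fps_const)

definition dilate :: "int fps \<Rightarrow> int fps" where
  "dilate F = F oo fps_X ^ 2"

lemma dilate_nth: "dilate F $ n = (if even n then F $ (n div 2) else 0)"
proof -
  have "dilate F $ n = (\<Sum>i = 0..n. if i = n div 2 \<and> even n then F $ i else 0)"
    unfolding dilate_def fps_compose_nth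
    by (intro sum.cong refl) (auto simp flip: power_mult)
  also have "\<dots> = (if even n then F $ (n div 2) else 0)"
    by (cases "even n") (simp_all add: sum.delta)
  finally show ?thesis .
qed

lemma dilate_add: "dilate (F + G) = dilate F + dilate G"
  and dilate_diff: "dilate (F - G) = dilate F - dilate G"
  and dilate_numeral: "dilate (numeral k) = numeral k"
  by (rule fps_ext; auto simp: dilate_nth fps_numeral_nth elim!: evenE; fail)+

lemma dilate_mult: "dilate (F * G) = dilate F * dilate G"
  unfolding dilate_def by (rule fps_compose_mult_distrib) simp

lemma euler_deriv_dilate: "euler_deriv (dilate F) = 2 * dilate (euler_deriv F)"
  by (rule fps_ext) (auto simp: dilate_nth euler_deriv_nth numeral_mult_fps_nth)

text \<open>Halving maps the even divisors of an even \<open>n\<close> onto the divisors of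
  \<open>n div 2\<close>; an odd \<open>n\<close> has no even divisors.\<close>

lemma divisor_fps_even:
  "divisor_fps (\<lambda>d. if even d then g (d div 2) else 0) = dilate (divisor_fps g)"
proof (rule fps_ext)
  fix n :: nat
  show "divisor_fps (\<lambda>d. if even d then g (d div 2) else 0) $ n = dilate (divisor_fps g) $ n"
  proof (cases "n = 0")
    case False
    have "(\<Sum>d | d dvd n. if even d then g (d div 2) else 0) = (\<Sum>d | d dvd n \<and> even d. g (d div 2))"
      using False by (intro sum.mono_neutral_cong_right) auto
    also have "\<dots> = (if even n then \<Sum>d | d dvd n div 2. g d else 0)"
    proof (cases "even n")
      case True
      then have "(\<Sum>d | d dvd n \<and> even d. g (d div 2)) = (\<Sum>d | d dvd n div 2. g d)"
        by (intro sum.reindex_bij_witness[where i = "\<lambda>d. 2 * d" and j = "\<lambda>d. d div 2"])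
           (auto elim!: evenE)
      with True show ?thesis by simp
    next
      case odd: False
      then have none: "{d. d dvd n \<and> even d} = {}" by auto
      show ?thesis using odd by (simp only: none) simp
    qed
    also have "\<dots> = dilate (divisor_fps g) $ n"
      using False by (auto simp: dilate_nth divisor_fps_nth elim!: evenE)
    finally show ?thesis using False by (simp add: divisor_fps_nth)
  qed (simp add: dilate_nth)
qed

lemma divisor_fps_scale: "divisor_fps (\<lambda>d. c * g d) = fps_const c * divisor_fps g"
  by (rule fps_ext) (simp add: divisor_fps_def sum_distrib_left)

lemma divisor_fps_diff: "divisor_fps (\<lambda>d. g d - h d) = divisor_fps g - divisor_fps h"
  by (rule fps_ext) (simp add: divisor_fps_def sum_subtractf)

section \<open>Divisor power sums split by the parity of the divisor\<close>

definition sigma_fps :: "nat \<Rightarrow> int fps" where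
  "sigma_fps k = divisor_fps (\<lambda>d. int d ^ k)"

definition sigma_even_fps :: "nat \<Rightarrow> int fps" where
  "sigma_even_fps k = divisor_fps (\<lambda>d. if even d then int d ^ k else 0)"

definition sigma_odd_fps :: "nat \<Rightarrow> int fps" where
  "sigma_odd_fps k = divisor_fps (\<lambda>d. if odd d then int d ^ k else 0)"

lemma sigma_odd_fps_eq: "sigma_odd_fps k = sigma_fps k - sigma_even_fps k"
  unfolding sigma_odd_fps_def sigma_even_fps_def sigma_fps_def divisor_fps_diff[symmetric]
  by (rule arg_cong[where f = divisor_fps]) auto

lemma sigma_even_fps_eq: "sigma_even_fps k = 2 ^ k * dilate (sigma_fps k)"
proof -
  have "sigma_even_fps k = divisor_fps (\<lambda>d. 2 ^ k * (if even d then int (d div 2) ^ k else 0))"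
    unfolding sigma_even_fps_def
    by (rule arg_cong[where f = divisor_fps]) (auto simp: fun_eq_iff power_mult_distrib elim!: evenE)
  also have "\<dots> = fps_const (2 ^ k) * dilate (sigma_fps k)"
    unfolding divisor_fps_scale sigma_fps_def divisor_fps_even[symmetric] ..
  finally show ?thesis by (simp add: numeral_fps_const fps_const_power)
qed

lemma power5_eq_xxxxx: "x ^ 5 = x * x * x * x * x" for x :: int
  by (simp add: eval_nat_numeral)

lemmas power_expand = power2_eq_square power3_eq_cube power4_eq_xxxx power5_eq_xxxxx

text \<open>This and the next three lemmas evaluate the inner sum over \<open>c\<close> in
  Liouville's identity for the four functions used below; the factors 6 and 30 clear
  denominators.\<close>

lemma sum_squares_less:
  "6 * (\<Sum>c = 1..<d. int c ^ 2) = 2 * int d ^ 3 - 3 * int d ^ 2 + int d"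
proof (induction d)
  case (Suc d)
  then show ?case
    by (cases "d = 0") (simp_all add: algebra_simps power_expand)
qed simp

lemma sum_fourth_powers_less:
  "30 * (\<Sum>c = 1..<d. int c ^ 4) = 6 * int d ^ 5 - 15 * int d ^ 4 + 10 * int d ^ 3 - int d"
proof (induction d)
  case (Suc d)
  then show ?case
    by (cases "d = 0") (simp_all add: algebra_simps power_expand)
qed simp

lemma sum_even_squares_less:
  "6 * (\<Sum>c = 1..<d. if even (int c) then int c ^ 2 else 0) =
     int d ^ 3 - int d + (if even d then 3 * int d - 3 * int d ^ 2 else 0)"
proof (induction d)
  case (Suc d)
  then show ?case
    by (cases "d = 0"; cases "even d") (simp_all add: algebra_simps power_expand)
qed simp

lemma sum_even_fourth_powers_less:
  "30 * (\<Sum>c = 1..<d. if even (int c) then int c ^ 4 else 0) =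
     3 * int d ^ 5 - 10 * int d ^ 3 + 7 * int d
     + (if even d then - 15 * int d ^ 4 + 30 * int d ^ 3 - 15 * int d else 0)"
proof (induction d)
  case (Suc d)
  then show ?case
    by (cases "d = 0"; cases "even d") (simp_all add: algebra_simps power_expand)
qed simp

text \<open>Liouville's identity is used with \<open>F x = x\<^sup>2\<close> and \<open>F x = x\<^sup>4\<close>; restricting these
  functions to even \<open>x\<close> singles out the pairs of divisors of equal parity.\<close>

lemma sigma1_square:
  "12 * sigma_fps 1 * sigma_fps 1 = 5 * sigma_fps 3 + sigma_fps 1 - 6 * euler_deriv (sigma_fps 1)"
proof (rule fps_ext)
  fix n :: nat
  show "(12 * sigma_fps 1 * sigma_fps 1) $ n =
    (5 * sigma_fps 3 + sigma_fps 1 - 6 * euler_deriv (sigma_fps 1)) $ n"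
  proof (cases "n = 0")
    case False
    then have n: "n > 0" by simp
    have "(12 * sigma_fps 1 * sigma_fps 1) $ n = 12 * (\<Sum>(a, b, x, y) \<in> quads n. int a ^ 1 * int b ^ 1)"
      by (simp only: mult.assoc numeral_mult_fps_nth sigma_fps_def divisor_fps_mult_nth)
    \<comment> \<open>From \<open>(a - b)^2 - (a + b)^2 = - 4 a b\<close>.\<close>
    also have "\<dots> = - 3 * (\<Sum>(a, b, x, y) \<in> quads n. (int a - int b) ^ 2 - (int a + int b) ^ 2)"
      by (simp add: sum_distrib_left case_prod_unfold power_expand algebra_simps)
    also have "\<dots> = - 3 * (\<Sum>d | d dvd n. (int (n div d) - 1) * (0 ^ 2 + 2 * int d ^ 2) - (int d - 1) * int d ^ 2
        - 2 * (\<Sum>c = 1..<d. int c ^ 2))"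
      by (subst liouville_identity[OF _ n, where F = "\<lambda>x. x ^ 2"]) auto
    \<comment> \<open>With \<open>n = d * m\<close>, the cofactor term \<open>m d^2\<close> equals
      \<open>n d\<close>; this is what produces the derivative of
      \<open>sigma_fps 1\<close>.\<close>
    also have "\<dots> = (\<Sum>d | d dvd n. 5 * int d ^ 3 + int d ^ 1 - 6 * (int n * int d ^ 1))"
      unfolding sum_distrib_left[of "- 3 :: int"]
    proof (rule sum.cong[OF refl])
      fix d assume "d \<in> {d. d dvd n}"
      then obtain m where m: "n = d * m" by auto
      then have "d > 0" using n by auto
      then show "- 3 * ((int (n div d) - 1) * (0 ^ 2 + 2 * int d ^ 2) - (int d - 1) * int d ^ 2
          - 2 * (\<Sum>c = 1..<d. int c ^ 2)) = 5 * int d ^ 3 + int d ^ 1 - 6 * (int n * int d ^ 1)"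
        using sum_squares_less[of d] m by (simp add: algebra_simps power_expand)
    qed
    also have "\<dots> = (5 * sigma_fps 3 + sigma_fps 1 - 6 * euler_deriv (sigma_fps 1)) $ n"
      by (simp add: numeral_mult_fps_nth euler_deriv_nth sigma_fps_def divisor_fps_nth n
          sum.distrib sum_subtractf sum_distrib_left)
    finally show ?thesis .
  qed (simp add: sigma_fps_def euler_deriv_nth)
qed

lemma sigma1_sigma3:
  "240 * sigma_fps 1 * sigma_fps 3 =
     21 * sigma_fps 5 + 10 * sigma_fps 3 - sigma_fps 1 - 30 * euler_deriv (sigma_fps 3)"
proof (rule fps_ext)
  fix n :: nat
  show "(240 * sigma_fps 1 * sigma_fps 3) $ n =
    (21 * sigma_fps 5 + 10 * sigma_fps 3 - sigma_fps 1 - 30 * euler_deriv (sigma_fps 3)) $ n"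
  proof (cases "n = 0")
    case False
    then have n: "n > 0" by simp
    \<comment> \<open>The product is taken in both orders because
      \<open>(a - b)^4 - (a + b)^4 = - 8 (a^3 b + a b^3)\<close> is symmetric.\<close>
    have "(240 * sigma_fps 1 * sigma_fps 3) $ n =
        120 * (sigma_fps 1 * sigma_fps 3) $ n + 120 * (sigma_fps 3 * sigma_fps 1) $ n"
      by (simp add: mult.assoc numeral_mult_fps_nth mult.commute[of "sigma_fps 3"])
    also have "\<dots> = 120 * (\<Sum>(a, b, x, y) \<in> quads n. int a ^ 1 * int b ^ 3)
        + 120 * (\<Sum>(a, b, x, y) \<in> quads n. int a ^ 3 * int b ^ 1)"
      by (simp only: sigma_fps_def divisor_fps_mult_nth)
    also have "\<dots> = - 15 * (\<Sum>(a, b, x, y) \<in> quads n. (int a - int b) ^ 4 - (int a + int b) ^ 4)"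
      by (simp add: sum_distrib_left case_prod_unfold power_expand algebra_simps flip: sum.distrib)
    also have "\<dots> = - 15 * (\<Sum>d | d dvd n. (int (n div d) - 1) * (0 ^ 4 + 2 * int d ^ 4) - (int d - 1) * int d ^ 4
        - 2 * (\<Sum>c = 1..<d. int c ^ 4))"
      by (subst liouville_identity[OF _ n, where F = "\<lambda>x. x ^ 4"]) auto
    also have "\<dots> = (\<Sum>d | d dvd n. 21 * int d ^ 5 + 10 * int d ^ 3 - int d ^ 1 - 30 * (int n * int d ^ 3))"
      unfolding sum_distrib_left[of "- 15 :: int"]
    proof (rule sum.cong[OF refl])
      fix d assume "d \<in> {d. d dvd n}"
      then obtain m where m: "n = d * m" by auto
      then have "d > 0" using n by auto
      then show "- 15 * ((int (n div d) - 1) * (0 ^ 4 + 2 * int d ^ 4) - (int d - 1) * int d ^ 4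
          - 2 * (\<Sum>c = 1..<d. int c ^ 4)) = 21 * int d ^ 5 + 10 * int d ^ 3 - int d ^ 1 - 30 * (int n * int d ^ 3)"
        using sum_fourth_powers_less[of d] m by (simp add: algebra_simps power_expand)
    qed
    also have "\<dots> = (21 * sigma_fps 5 + 10 * sigma_fps 3 - sigma_fps 1 - 30 * euler_deriv (sigma_fps 3)) $ n"
      by (simp add: numeral_mult_fps_nth euler_deriv_nth sigma_fps_def divisor_fps_nth n
          sum.distrib sum_subtractf sum_distrib_left)
    finally show ?thesis .
  qed (simp add: sigma_fps_def euler_deriv_nth)
qed

lemma sigma1_square_parity:
  "12 * (sigma_odd_fps 1 * sigma_odd_fps 1 + sigma_even_fps 1 * sigma_even_fps 1) =
     3 * sigma_even_fps 3 + sigma_fps 3 - sigma_fps 1 + 3 * sigma_even_fps 1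
     - 6 * euler_deriv (sigma_even_fps 1)" (is "?L = ?R")
proof (rule fps_ext)
  fix n :: nat
  let ?F = "\<lambda>k x :: int. if even x then x ^ k else 0"
  let ?e = "\<lambda>k d. if even d then int d ^ k else 0"
  let ?o = "\<lambda>k d. if odd d then int d ^ k else 0"
  show "?L $ n = ?R $ n"
  proof (cases "n = 0")
    case False
    then have n: "n > 0" by simp
    have "?L $ n = 12 * ((\<Sum>(a, b, x, y) \<in> quads n. ?o 1 a * ?o 1 b) + (\<Sum>(a, b, x, y) \<in> quads n. ?e 1 a * ?e 1 b))"
      by (simp only: fps_add_nth numeral_mult_fps_nth sigma_odd_fps_def sigma_even_fps_def divisor_fps_mult_nth)
    also have "\<dots> = (\<Sum>(a, b, x, y) \<in> quads n. 12 * (?o 1 a * ?o 1 b + ?e 1 a * ?e 1 b))"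
      by (simp only: sum_distrib_left case_prod_unfold flip: sum.distrib)
    also have "\<dots> = (\<Sum>(a, b, x, y) \<in> quads n. - 3 * (?F 2 (int a - int b) - ?F 2 (int a + int b)))"
      by (intro sum.cong refl) (auto simp: power_expand algebra_simps)
    also have "\<dots> = - 3 * (\<Sum>(a, b, x, y) \<in> quads n. ?F 2 (int a - int b) - ?F 2 (int a + int b))"
      by (simp only: sum_distrib_left case_prod_unfold)
    also have "\<dots> = - 3 * (\<Sum>d | d dvd n. (int (n div d) - 1) * (?F 2 0 + 2 * ?F 2 (int d)) - (int d - 1) * ?F 2 (int d)
        - 2 * (\<Sum>c = 1..<d. ?F 2 (int c)))"
      by (subst liouville_identity[OF _ n, where F = "?F 2"]) auto
    also have "\<dots> = (\<Sum>d | d dvd n. 3 * ?e 3 d + int d ^ 3 - int d ^ 1 + 3 * ?e 1 d - 6 * (int n * ?e 1 d))"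
      unfolding sum_distrib_left[of "- 3 :: int"]
    proof (rule sum.cong[OF refl])
      fix d assume "d \<in> {d. d dvd n}"
      then obtain m where m: "n = d * m" by auto
      then have "d > 0" using n by auto
      then show "- 3 * ((int (n div d) - 1) * (?F 2 0 + 2 * ?F 2 (int d)) - (int d - 1) * ?F 2 (int d)
          - 2 * (\<Sum>c = 1..<d. ?F 2 (int c))) = 3 * ?e 3 d + int d ^ 3 - int d ^ 1 + 3 * ?e 1 d - 6 * (int n * ?e 1 d)"
        using sum_even_squares_less[of d] m
        by (cases "even d") (simp_all add: algebra_simps power_expand)
    qed
    also have "\<dots> = ?R $ n"
      by (simp only: fps_add_nth fps_sub_nth numeral_mult_fps_nth euler_deriv_nth sigma_fps_def
          sigma_even_fps_def divisor_fps_nth n sum.distrib sum_subtractf sum_distrib_left)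
    finally show ?thesis .
  qed (simp add: sigma_fps_def sigma_even_fps_def sigma_odd_fps_def euler_deriv_nth)
qed

lemma sigma1_sigma3_parity:
  "240 * (sigma_odd_fps 1 * sigma_odd_fps 3 + sigma_even_fps 1 * sigma_even_fps 3) =
     15 * sigma_even_fps 5 + 3 * sigma_fps 5 - 10 * sigma_fps 3 + 7 * sigma_fps 1
     + 30 * sigma_even_fps 3 - 15 * sigma_even_fps 1 - 30 * euler_deriv (sigma_even_fps 3)"
  (is "?L = ?R")
proof (rule fps_ext)
  fix n :: nat
  let ?F = "\<lambda>k x :: int. if even x then x ^ k else 0"
  let ?e = "\<lambda>k d. if even d then int d ^ k else 0"
  let ?o = "\<lambda>k d. if odd d then int d ^ k else 0"
  show "?L $ n = ?R $ n"
  proof (cases "n = 0")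
    case False
    then have n: "n > 0" by simp
    have "?L = 120 * (sigma_odd_fps 1 * sigma_odd_fps 3 + sigma_even_fps 1 * sigma_even_fps 3
      + sigma_odd_fps 3 * sigma_odd_fps 1 + sigma_even_fps 3 * sigma_even_fps 1)"
      by (simp add: algebra_simps)
    then have "?L $ n = 120 * ((\<Sum>(a, b, x, y) \<in> quads n. ?o 1 a * ?o 3 b) + (\<Sum>(a, b, x, y) \<in> quads n. ?e 1 a * ?e 3 b)
        + (\<Sum>(a, b, x, y) \<in> quads n. ?o 3 a * ?o 1 b) + (\<Sum>(a, b, x, y) \<in> quads n. ?e 3 a * ?e 1 b))"
      by (simp only: fps_add_nth numeral_mult_fps_nth sigma_odd_fps_def sigma_even_fps_def divisor_fps_mult_nth)
    also have "\<dots> = (\<Sum>(a, b, x, y) \<in> quads n.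
        120 * (?o 1 a * ?o 3 b + ?e 1 a * ?e 3 b + ?o 3 a * ?o 1 b + ?e 3 a * ?e 1 b))"
      by (simp only: sum_distrib_left case_prod_unfold flip: sum.distrib)
    also have "\<dots> = (\<Sum>(a, b, x, y) \<in> quads n. - 15 * (?F 4 (int a - int b) - ?F 4 (int a + int b)))"
      by (intro sum.cong refl) (auto simp: power_expand algebra_simps)
    also have "\<dots> = - 15 * (\<Sum>(a, b, x, y) \<in> quads n. ?F 4 (int a - int b) - ?F 4 (int a + int b))"
      by (simp only: sum_distrib_left case_prod_unfold)
    also have "\<dots> = - 15 * (\<Sum>d | d dvd n. (int (n div d) - 1) * (?F 4 0 + 2 * ?F 4 (int d)) - (int d - 1) * ?F 4 (int d)
        - 2 * (\<Sum>c = 1..<d. ?F 4 (int c)))"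
      by (subst liouville_identity[OF _ n, where F = "?F 4"]) auto
    also have "\<dots> = (\<Sum>d | d dvd n. 15 * ?e 5 d + 3 * int d ^ 5 - 10 * int d ^ 3 + 7 * int d ^ 1
        + 30 * ?e 3 d - 15 * ?e 1 d - 30 * (int n * ?e 3 d))"
      unfolding sum_distrib_left[of "- 15 :: int"]
    proof (rule sum.cong[OF refl])
      fix d assume "d \<in> {d. d dvd n}"
      then obtain m where m: "n = d * m" by auto
      then have "d > 0" using n by auto
      then show "- 15 * ((int (n div d) - 1) * (?F 4 0 + 2 * ?F 4 (int d)) - (int d - 1) * ?F 4 (int d)
          - 2 * (\<Sum>c = 1..<d. ?F 4 (int c))) = 15 * ?e 5 d + 3 * int d ^ 5 - 10 * int d ^ 3 + 7 * int d ^ 1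
        + 30 * ?e 3 d - 15 * ?e 1 d - 30 * (int n * ?e 3 d)"
        using sum_even_fourth_powers_less[of d] m
        by (cases "even d") (simp_all add: algebra_simps power_expand)
    qed
    also have "\<dots> = ?R $ n"
      by (simp only: fps_add_nth fps_sub_nth numeral_mult_fps_nth euler_deriv_nth sigma_fps_def
          sigma_even_fps_def divisor_fps_nth n sum.distrib sum_subtractf sum_distrib_left)
    finally show ?thesis .
  qed (simp add: sigma_fps_def sigma_even_fps_def sigma_odd_fps_def euler_deriv_nth)
qed

lemma sigma1_even_square:
  "24 * sigma_even_fps 1 * sigma_even_fps 1 =
     5 * sigma_even_fps 3 + 4 * sigma_even_fps 1 - 12 * euler_deriv (sigma_even_fps 1)"
proof -
  let ?U = "dilate (sigma_fps 1)" and ?S = "dilate (sigma_fps 3)"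
  have "12 * ?U * ?U = 5 * ?S + ?U - 6 * dilate (euler_deriv (sigma_fps 1))" (is "?l = ?r")
    using arg_cong[OF sigma1_square, of dilate]
    by (simp only: dilate_mult dilate_add dilate_diff dilate_numeral)
  \<comment> \<open>The factor \<open>8 = 2^3\<close> turns \<open>?S\<close> into
    \<open>sigma_even_fps 3\<close>.\<close>
  then have "8 * ?l = 8 * ?r" by simp
  then show ?thesis
    unfolding sigma_even_fps_eq
    by (simp add: euler_deriv_simps euler_deriv_dilate algebra_simps)
qed

lemma sigma1_sigma3_even:
  "480 * sigma_even_fps 1 * sigma_even_fps 3 =
     21 * sigma_even_fps 5 + 40 * sigma_even_fps 3 - 16 * sigma_even_fps 1
     - 60 * euler_deriv (sigma_even_fps 3)"
proof -
  let ?U = "dilate (sigma_fps 1)" and ?S = "dilate (sigma_fps 3)" and ?T = "dilate (sigma_fps 5)"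
  have "240 * ?U * ?S = 21 * ?T + 10 * ?S - ?U - 30 * dilate (euler_deriv (sigma_fps 3))"
    (is "?l = ?r")
    using arg_cong[OF sigma1_sigma3, of dilate]
    by (simp only: dilate_mult dilate_add dilate_diff dilate_numeral)
  \<comment> \<open>The factor \<open>32 = 2^5\<close> turns \<open>?T\<close> into
    \<open>sigma_even_fps 5\<close>.\<close>
  then have "32 * ?l = 32 * ?r" by simp
  then show ?thesis
    unfolding sigma_even_fps_eq
    by (simp add: euler_deriv_simps euler_deriv_dilate algebra_simps)
qed

section \<open>Eisenstein series and the congruences\<close>

text \<open>With \<open>E\<^sub>2, E\<^sub>4, E\<^sub>6\<close> the usual Eisenstein series in \<open>q\<close>, \<open>level2_fps\<close> is
  \<open>2 E\<^sub>2(q\<^sup>2) - E\<^sub>2(q)\<close>, of weight 2 on \<open>\<Gamma>\<^sub>0(2)\<close>.\<close>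

definition e2_fps :: "int fps" where "e2_fps = 1 - 24 * sigma_fps 1"
definition e4_fps :: "int fps" where "e4_fps = 1 + 240 * sigma_fps 3"
definition e6_fps :: "int fps" where "e6_fps = 1 - 504 * sigma_fps 5"
definition level2_fps :: "int fps" where "level2_fps = 1 + 24 * sigma_odd_fps 1"

text \<open>A rescaling of \<open>sigma1_square\<close>. Together with \<open>euler_deriv_e4\<close>
  and \<open>euler_deriv_e6\<close> this forms Ramanujan's system.\<close>

lemma euler_deriv_e2: "12 * euler_deriv e2_fps = e2_fps ^ 2 - e4_fps"
  using sigma1_square unfolding e2_fps_def e4_fps_def euler_deriv_simps by algebra

lemma euler_deriv_e4: "3 * euler_deriv e4_fps = e2_fps * e4_fps - e6_fps"
  using sigma1_sigma3 unfolding e2_fps_def e4_fps_def e6_fps_def euler_deriv_simps by algebra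

text \<open>Writing the odd part as total minus even part, the parity identity supplies the mixed
  product of \<open>sigma_fps 1\<close> and \<open>sigma_even_fps 1\<close>; the other two
  identities supply their squares.\<close>

lemma euler_deriv_level2:
  "6 * euler_deriv level2_fps = e2_fps * level2_fps - 2 * level2_fps ^ 2 + e4_fps"
  using sigma1_square sigma1_even_square sigma1_square_parity
  unfolding e2_fps_def e4_fps_def level2_fps_def sigma_odd_fps_eq euler_deriv_simps by algebra

text \<open>The derivatives of \<open>sigma_even_fps 1\<close> cancel between the two identities. As
  \<open>sigma_even_fps 3\<close> is 8 times a dilated series, the right side is
  \<open>E_4(q) + 4 E_4(q^2)\<close>.\<close>

lemma level2_square: "5 * level2_fps ^ 2 = e4_fps + 4 + 120 * sigma_even_fps 3"
  using sigma1_even_square sigma1_square_parity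
  unfolding e4_fps_def level2_fps_def sigma_odd_fps_eq by algebra

text \<open>Two relations express \<open>E_6(q) + 8 E_6(q^2)\<close> and
  \<open>- E_6(q) - 48 E_6(q^2)\<close> through \<open>f\<close> and \<open>E_4\<close>: one by
  differentiating \<open>level2_square\<close>, one from the parity convolution. Eliminating
  \<open>E_6(q^2)\<close> leaves the claim.\<close>

lemma e6_eq: "e6_fps = 4 * level2_fps ^ 3 - 3 * level2_fps * e4_fps"
proof -
  let ?f = level2_fps
  have deriv: "10 * ?f * euler_deriv ?f = euler_deriv e4_fps + 120 * euler_deriv (sigma_even_fps 3)"
    using arg_cong[OF level2_square, of euler_deriv]
    unfolding euler_deriv_simps power2_eq_square e4_fps_def by algebra
  have 1: "e6_fps + 8 - 126 * sigma_even_fps 5 = 15 * ?f ^ 3 - 6 * ?f * e4_fps"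
    using deriv euler_deriv_e4 euler_deriv_level2 level2_square sigma1_sigma3_even
    unfolding e2_fps_def e4_fps_def e6_fps_def level2_fps_def sigma_odd_fps_eq
    by algebra
  \<comment> \<open>By \<open>level2_square\<close> the bracket equals
    \<open>240 * sigma_odd_fps 3 - 7\<close>, which brings in the product of the two odd
    series.\<close>
  have 2: "7 * ?f * (3 * e4_fps - 10 * ?f ^ 2) = - e6_fps - 48 + 756 * sigma_even_fps 5"
    using level2_square sigma1_sigma3_even sigma1_sigma3_parity
    unfolding e4_fps_def e6_fps_def level2_fps_def sigma_odd_fps_eq
    by algebra
  \<comment> \<open>Six times \<open>1\<close> plus \<open>2\<close>, since
    \<open>6 * 126 = 756\<close>.\<close>
  have "5 * e6_fps = 5 * (4 * level2_fps ^ 3 - 3 * level2_fps * e4_fps)"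
    using 1 2 by algebra
  then show ?thesis by (simp only: mult_cancel_left) simp
qed

text \<open>Obtained by differentiating \<open>e6_eq\<close>, in place of a convolution with fifth
  powers.\<close>

lemma euler_deriv_e6: "2 * euler_deriv e6_fps = e2_fps * e6_fps - e4_fps ^ 2"
proof -
  have "euler_deriv e6_fps = 12 * level2_fps ^ 2 * euler_deriv level2_fps
      - 3 * (euler_deriv level2_fps * e4_fps + level2_fps * euler_deriv e4_fps)"
    unfolding e6_eq power2_eq_square power3_eq_cube euler_deriv_simps by algebra
  then show ?thesis
    using euler_deriv_level2 euler_deriv_e4 e6_eq by algebra
qed

section \<open>Derivatives of \<open>P f\<close> and the congruences between power series\<close>

lemma euler_deriv_mult_level2:
  assumes P: "24 * euler_deriv P = P * (level2_fps - e2_fps)"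
  shows "24 * euler_deriv (P * level2_fps) =
     P * (3 * e2_fps * level2_fps - 7 * level2_fps ^ 2 + 4 * e4_fps)"
  using P euler_deriv_level2 unfolding euler_deriv_simps by algebra

text \<open>Each derivative costs one factor 24, whence \<open>576 = 24^2\<close> and later
  \<open>13824 = 24^3\<close>. The derivative of \<open>e4_fps\<close> stays unexpanded because it
  is a multiple of 240 and so vanishes modulo 5.\<close>

lemma euler_deriv2_mult_level2:
  assumes P: "24 * euler_deriv P = P * (level2_fps - e2_fps)"
  shows "576 * euler_deriv (euler_deriv (P * level2_fps)) =
     P * (15 * e2_fps ^ 2 * level2_fps - 70 * e2_fps * level2_fps ^ 2 + 105 * level2_fps ^ 3
       + 8 * e2_fps * e4_fps - 58 * level2_fps * e4_fps + 96 * euler_deriv e4_fps)"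
proof -
  have "24 * euler_deriv (euler_deriv (P * level2_fps)) =
    euler_deriv P * (3 * e2_fps * level2_fps - 7 * level2_fps ^ 2 + 4 * e4_fps)
    + P * (3 * euler_deriv e2_fps * level2_fps + 3 * e2_fps * euler_deriv level2_fps
      - 14 * level2_fps * euler_deriv level2_fps + 4 * euler_deriv e4_fps)"
    using arg_cong[OF euler_deriv_mult_level2[OF P], of euler_deriv]
    unfolding euler_deriv_simps power2_eq_square by algebra
  then show ?thesis
    using P euler_deriv_e2 euler_deriv_level2 by algebra
qed

lemma euler_deriv3_mult_level2:
  assumes P: "24 * euler_deriv P = P * (level2_fps - e2_fps)"
  shows "13824 * euler_deriv (euler_deriv (euler_deriv (P * level2_fps))) =
     P * (105 * e2_fps ^ 3 * level2_fps - 735 * e2_fps ^ 2 * level2_fps ^ 2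
       - 483 * e2_fps * level2_fps ^ 3 - 687 * level2_fps ^ 4 + 420 * e2_fps ^ 2 * e4_fps
       + 798 * e2_fps * level2_fps * e4_fps + 510 * level2_fps ^ 2 * e4_fps + 72 * e4_fps ^ 2)"
proof -
  let ?D = euler_deriv and ?e = e2_fps and ?f = level2_fps and ?x = e4_fps
  \<comment> \<open>Here the derivative of \<open>E_4\<close> is eliminated through
    \<open>e6_eq\<close>, leaving a polynomial in \<open>e\<close>, \<open>f\<close> and
    \<open>E_4\<close>.\<close>
  have "576 * ?D (?D (P * ?f)) =
      P * (15 * ?e ^ 2 * ?f - 70 * ?e * ?f ^ 2 - 23 * ?f ^ 3 + 40 * ?e * ?x + 38 * ?f * ?x)"
    using euler_deriv2_mult_level2[OF P] euler_deriv_e4 e6_eq by algebra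
  from arg_cong[OF this, of ?D]
  have "576 * ?D (?D (?D (P * ?f))) =
      ?D P * (15 * ?e ^ 2 * ?f - 70 * ?e * ?f ^ 2 - 23 * ?f ^ 3 + 40 * ?e * ?x + 38 * ?f * ?x)
      + P * (30 * ?e * ?D ?e * ?f + 15 * ?e ^ 2 * ?D ?f - 70 * ?D ?e * ?f ^ 2 - 140 * ?e * ?f * ?D ?f
        - 69 * ?f ^ 2 * ?D ?f + 40 * ?D ?e * ?x + 40 * ?e * ?D ?x + 38 * ?D ?f * ?x + 38 * ?f * ?D ?x)"
    unfolding euler_deriv_simps power2_eq_square power3_eq_cube by algebra
  moreover have "24 * ?D ?x = 8 * ?e * ?x - 32 * ?f ^ 3 + 24 * ?f * ?x"
    using euler_deriv_e4 e6_eq by algebra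
  ultimately show ?thesis
    using P euler_deriv_e2 euler_deriv_level2 by algebra
qed

text \<open>With \<open>E_4 = 1\<close> modulo 5, the second derivative leaves
  \<open>P (8 e - 58 f)\<close>. The hypothesis turns \<open>192 D P\<close> into
  \<open>8 P (f - e)\<close>, and the sum is \<open>- 50 P f\<close>.\<close>

lemma level2_mod_5:
  assumes P: "24 * euler_deriv P = P * (level2_fps - e2_fps)"
  shows "(5 :: int fps) dvd 576 * euler_deriv (euler_deriv (P * level2_fps)) + 192 * euler_deriv P"
proof
  show "576 * euler_deriv (euler_deriv (P * level2_fps)) + 192 * euler_deriv P =
    5 * (P * (3 * e2_fps ^ 2 * level2_fps - 14 * e2_fps * level2_fps ^ 2 + 21 * level2_fps ^ 3
      + 384 * e2_fps * sigma_fps 3 - 2784 * level2_fps * sigma_fps 3 - 10 * level2_fps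
      + 4608 * euler_deriv (sigma_fps 3)))"
    using euler_deriv2_mult_level2[OF P] P unfolding e4_fps_def euler_deriv_simps by algebra
qed

text \<open>Write \<open>x\<close> for \<open>E_4\<close>. Modulo 7 the sum reduces to
  \<open>P (- f^4 - f^2 x + 2 x^2 + 2 f - 2 e)\<close>. As \<open>504 = 7 * 72\<close>,
  \<open>E_6 = 1\<close>: then \<open>e6_eq\<close> times \<open>f\<close> gives
  \<open>f^4 + f^2 x = 2 f\<close>, the derivative of \<open>E_6\<close> gives
  \<open>x^2 = e\<close>, and everything cancels.\<close>

lemma level2_mod_7:
  assumes P: "24 * euler_deriv P = P * (level2_fps - e2_fps)"
  shows "(7 :: int fps) dvd 13824 * (euler_deriv (euler_deriv (euler_deriv (P * level2_fps))) + euler_deriv P)"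
proof
  let ?e = e2_fps and ?f = level2_fps and ?x = e4_fps and ?T = "sigma_fps 5"
  have "2 * - (504 * euler_deriv ?T) = ?e * (1 - 504 * ?T) - ?x ^ 2"
    using euler_deriv_e6 unfolding e6_fps_def euler_deriv_simps by algebra
  moreover have "1 - 504 * ?T = 4 * ?f ^ 3 - 3 * ?f * ?x"
    using e6_eq unfolding e6_fps_def .
  ultimately show "13824 * (euler_deriv (euler_deriv (euler_deriv (P * ?f))) + euler_deriv P) =
    7 * (P * (15 * ?e ^ 3 * ?f - 105 * ?e ^ 2 * ?f ^ 2 - 69 * ?e * ?f ^ 3 + 60 * ?e ^ 2 * ?x
      + 114 * ?e * ?f * ?x + 231 * ?f ^ 4 - 174 * ?f ^ 2 * ?x + 41472 * ?f * ?T - 72 * ?e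
      - 5184 * ?e * ?T + 10368 * euler_deriv ?T))"
    using euler_deriv3_mult_level2[OF P] P by algebra
qed

section \<open>Overpartitions\<close>

lemma size_le_sum_mset_fst:
  assumes "\<forall>p \<in># M. fst p > (0 :: nat)"
  shows "size M \<le> sum_mset (image_mset fst M)"
  using assms
proof (induction M)
  case (add p M)
  then have "size M \<le> sum_mset (image_mset fst M)" "fst p > 0" by auto
  then show ?case by simp
qed simp

lemma overpartition_part_range:
  assumes "M \<in> overpartitions n" "p \<in># M"
  shows "fst p \<in> {1..n}"
proof -
  have "sum_mset (image_mset fst M) = fst p + sum_mset (image_mset fst (M - {#p#}))"
    using assms(2) by (metis image_mset_add_mset insert_DiffM sum_mset.add_mset)
  then show ?thesis using assms by (auto simp: overpartitions_def Suc_le_eq)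
qed

lemma finite_overpartitions [simp]: "finite (overpartitions n)"
proof (rule finite_subset)
  show "overpartitions n \<subseteq> (\<Union>k \<in> {..n}. multisets_of_size ({1..n} \<times> UNIV) k)"
  proof
    fix M assume M: "M \<in> overpartitions n"
    then have "size M \<le> n" using size_le_sum_mset_fst[of M] by (simp add: overpartitions_def)
    moreover have "set_mset M \<subseteq> {1..n} \<times> UNIV"
      using overpartition_part_range[OF M] by auto
    ultimately show "M \<in> (\<Union>k \<in> {..n}. multisets_of_size ({1..n} \<times> UNIV) k)"
      by (auto simp: multisets_of_size_def)
  qed
qed (auto intro: finite_multisets_of_size)

definition overpartition_fps :: "int fps" where
  "overpartition_fps = Abs_fps (\<lambda>n. int (card (overpartitions n)))"

definition part_count :: "nat \<times> bool \<Rightarrow> nat \<Rightarrow> int" where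
  "part_count p n = (\<Sum>M \<in> overpartitions n. int (count M p))"

text \<open>The sign in the expansion of \<open>q^k / (1 - q^k)\<close> for a repeatable part and of
  \<open>q^k / (1 + q^k)\<close> for an overlined one.\<close>

definition mark_sign :: "bool \<Rightarrow> int" where
  "mark_sign b = (if b then - 1 else 1)"

definition part_sum :: "bool \<Rightarrow> nat \<Rightarrow> int" where
  "part_sum b n = (\<Sum>M \<in> overpartitions n. int (sum_mset (image_mset fst (filter_mset (\<lambda>p. snd p = b) M))))"

lemma part_sum_eq: "part_sum False n = int (nov n)" "part_sum True n = int (ov n)"
  by (simp_all add: part_sum_def nov_def ov_def)

text \<open>Removing one copy of the part is a bijection onto the overpartitions of \<open>n - k\<close> in
  which another copy may still be inserted; for an overlined part these are the ones
  without it.\<close>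

lemma part_count_rec:
  assumes k: "k > 0"
  shows "part_count (k, b) n =
    (if k \<le> n then overpartition_fps $ (n - k) + mark_sign b * part_count (k, b) (n - k) else 0)"
proof -
  let ?p = "(k, b)"
  have restrict: "part_count ?p n = (\<Sum>M \<in> {M \<in> overpartitions n. ?p \<in># M}. int (count M ?p))"
    unfolding part_count_def by (rule sum.mono_neutral_right) (auto simp: not_in_iff)
  show ?thesis
  proof (cases "k \<le> n")
    case False
    then have none: "{M \<in> overpartitions n. ?p \<in># M} = {}"
      using overpartition_part_range[of _ n ?p] by auto
    show ?thesis using False by (simp only: restrict none) simp
  next
    case True
    let ?A = "{M \<in> overpartitions (n - k). b \<longrightarrow> ?p \<notin># M}"
    have "part_count ?p n = (\<Sum>M \<in> ?A. int (count M ?p) + 1)"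
      unfolding restrict
    proof (rule sum.reindex_bij_witness[where i = "add_mset ?p" and j = "\<lambda>M. M - {#?p#}"])
      fix M assume M: "M \<in> {M \<in> overpartitions n. ?p \<in># M}"
      then obtain N where N: "M = add_mset ?p N" by (auto dest: multi_member_split)
      show "add_mset ?p (M - {#?p#}) = M" using N by simp
      show "int (count (M - {#?p#}) ?p) + 1 = int (count M ?p)" using N by simp
      have "count N (j, True) \<le> 1" for j
      proof -
        have "count N (j, True) \<le> count M (j, True)" using N by simp
        also have "\<dots> \<le> 1" using M by (simp add: overpartitions_def)
        finally show ?thesis .
      qed
      moreover have "b \<longrightarrow> ?p \<notin># N"
      proof
        assume b
        moreover have "count M (k, True) \<le> 1" using M by (simp add: overpartitions_def)
        ultimately show "?p \<notin># N" using N by (simp add: not_in_iff)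
      qed
      ultimately show "M - {#?p#} \<in> ?A" using M N by (auto simp: overpartitions_def)
    next
      fix N assume N: "N \<in> ?A"
      show "add_mset ?p N - {#?p#} = N" by simp
      show "add_mset ?p N \<in> {M \<in> overpartitions n. ?p \<in># M}"
        using N k True by (auto simp: overpartitions_def not_in_iff)
    qed
    \<comment> \<open>For an overlined part the new weight is 1 on \<open>?A\<close> and 0
      elsewhere, because the count is at most 1.\<close>
    also have "\<dots> = (\<Sum>M \<in> overpartitions (n - k). 1 + mark_sign b * int (count M ?p))"
    proof (rule sum.mono_neutral_cong_left)
      show "\<forall>M \<in> overpartitions (n - k) - ?A. 1 + mark_sign b * int (count M ?p) = 0"
      proof
        fix M assume M: "M \<in> overpartitions (n - k) - ?A"
        then have b: b and "count M ?p \<ge> 1" by (auto simp: Suc_le_eq)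
        moreover have "count M ?p \<le> 1" using M b by (simp add: overpartitions_def)
        ultimately have "count M ?p = 1" by linarith
        then show "1 + mark_sign b * int (count M ?p) = 0" using b by (simp add: mark_sign_def)
      qed
    qed (auto simp: mark_sign_def not_in_iff)
    also have "\<dots> = overpartition_fps $ (n - k) + mark_sign b * part_count ?p (n - k)"
      by (simp add: overpartition_fps_def part_count_def sum.distrib sum_distrib_left)
    finally show ?thesis using True by simp
  qed
qed

text \<open>Iterating the recursion expands a geometric series in \<open>q^k\<close>; the term for
  \<open>m = j k\<close> carries the sign to the power \<open>j - 1\<close>.\<close>

lemma part_count_eq:
  assumes k: "k > 0"
  shows "part_count (k, b) n =
    (\<Sum>m | m \<in> {1..n} \<and> k dvd m. mark_sign b ^ (m div k - 1) * overpartition_fps $ (n - m))"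
proof (induction n rule: less_induct)
  case (less n)
  let ?f = "\<lambda>m. mark_sign b ^ (m div k - 1) * overpartition_fps $ (n - m)"
  show ?case
  proof (cases "k \<le> n")
    case False
    then have none: "{m. m \<in> {1..n} \<and> k dvd m} = {}" by (auto dest: dvd_imp_le)
    show ?thesis using False by (simp only: none part_count_rec[OF k, of b n]) simp
  next
    case True
    have split: "{m. m \<in> {1..n} \<and> k dvd m} = insert k {m. m \<in> {k<..n} \<and> k dvd m}"
      using k True by (auto dest: dvd_imp_le)
    have "(\<Sum>m | m \<in> {k<..n} \<and> k dvd m. ?f m) =
      (\<Sum>m | m \<in> {1..n - k} \<and> k dvd m. mark_sign b * (mark_sign b ^ (m div k - 1) * overpartition_fps $ (n - k - m)))"
    proof (rule sum.reindex_bij_witness[where i = "\<lambda>m. m + k" and j = "\<lambda>m. m - k"])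
      fix m assume m: "m \<in> {m. m \<in> {k<..n} \<and> k dvd m}"
      then obtain j where j: "m = k * j" by auto
      with m k have "j > 1" by auto
      then obtain i where i: "j = Suc (Suc i)" by (auto dest: less_imp_Suc_add)
      show "mark_sign b * (mark_sign b ^ ((m - k) div k - 1) * overpartition_fps $ (n - k - (m - k))) = ?f m"
        using k m by (simp add: j i)
    qed (use k in \<open>auto simp: dvd_minus_self\<close>)
    then have "(\<Sum>m | m \<in> {1..n} \<and> k dvd m. ?f m) =
        overpartition_fps $ (n - k) + mark_sign b * part_count (k, b) (n - k)"
      unfolding split using k True less.IH[of "n - k"]
      by (subst sum.insert) (auto simp: sum_distrib_left)
    then show ?thesis using True by (simp add: part_count_rec[OF k, of b n])
  qed
qed

section \<open>Generating functions of the part sums\<close>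

lemma sum_mset_parts:
  assumes "\<forall>p \<in># M. fst p \<in> {1..n}"
  shows "sum_mset (image_mset fst (filter_mset (\<lambda>p. snd p = b) M)) = (\<Sum>k = 1..n. k * count M (k, b))"
  using assms
proof (induction M)
  case (add p M)
  have "(\<Sum>k = 1..n. k * count (add_mset p M) (k, b)) =
      (\<Sum>k = 1..n. k * count M (k, b) + (if k = fst p then (if snd p = b then k else 0) else 0))"
    by (intro sum.cong) (auto simp: prod_eq_iff)
  then show ?case using add by (simp add: sum.distrib sum.delta)
qed simp

text \<open>In the overlined case each \<open>k\<close> with \<open>m div k\<close> even changes the
  full divisor sum by \<open>- 2 k\<close>. Such \<open>2 k\<close> run exactly through the even
  divisors of \<open>m\<close>, so the odd ones remain.\<close>

lemma signed_divisor_sum: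
  assumes "m > 0"
  shows "(\<Sum>k | k dvd m. int k * mark_sign b ^ (m div k - 1)) =
    (if b then sigma_odd_fps 1 else sigma_fps 1) $ m"
proof (cases b)
  case False
  then show ?thesis using assms by (simp add: mark_sign_def sigma_fps_def divisor_fps_nth)
next
  case True
  have "(\<Sum>k | k dvd m. int k * mark_sign b ^ (m div k - 1)) =
      (\<Sum>k | k dvd m. int k - (if even (m div k) then 2 * int k else 0))"
  proof (rule sum.cong[OF refl])
    fix k assume "k \<in> {k. k dvd m}"
    then have "m div k > 0" using assms by (auto elim!: dvdE)
    then show "int k * mark_sign b ^ (m div k - 1) = int k - (if even (m div k) then 2 * int k else 0)"
      using True by (cases "even (m div k)") (simp_all add: mark_sign_def)
  qed
  also have "\<dots> = (\<Sum>k | k dvd m. int k) - (\<Sum>k | k dvd m. if even (m div k) then 2 * int k else 0)"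
    by (simp add: sum_subtractf)
  also have "(\<Sum>k | k dvd m. if even (m div k) then 2 * int k else 0) =
      (\<Sum>k | k dvd m \<and> even (m div k). 2 * int k)"
    using assms by (intro sum.mono_neutral_cong_right) auto
  also have "\<dots> = (\<Sum>d | d dvd m \<and> even d. int d)"
    using assms
    by (intro sum.reindex_bij_witness[where i = "\<lambda>d. d div 2" and j = "\<lambda>k. 2 * k"])
       (auto elim!: dvdE)
  also have "\<dots> = (\<Sum>d | d dvd m. if even d then int d else 0)"
    using assms by (intro sum.mono_neutral_cong_left) auto
  finally show ?thesis
    using True assms
    by (simp add: sigma_odd_fps_eq sigma_fps_def sigma_even_fps_def divisor_fps_nth cong: if_cong)
qed

text \<open>Weighting the count of each part by its size and exchanging the sums over
  \<open>k\<close> and its multiples \<open>m\<close> collects a signed divisor sum at each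
  \<open>m\<close>.\<close>

lemma part_sum_fps:
  "Abs_fps (part_sum b) = overpartition_fps * (if b then sigma_odd_fps 1 else sigma_fps 1)"
proof (rule fps_ext)
  fix n
  let ?g = "\<lambda>m k. int k * mark_sign b ^ (m div k - 1)"
  let ?s = "if b then sigma_odd_fps 1 else sigma_fps 1"
  have "part_sum b n = (\<Sum>M \<in> overpartitions n. \<Sum>k = 1..n. int k * int (count M (k, b)))"
    unfolding part_sum_def
  proof (rule sum.cong[OF refl])
    fix M assume "M \<in> overpartitions n"
    then have "\<forall>p \<in># M. fst p \<in> {1..n}" by (blast intro: overpartition_part_range)
    then show "int (sum_mset (image_mset fst (filter_mset (\<lambda>p. snd p = b) M))) =
        (\<Sum>k = 1..n. int k * int (count M (k, b)))"
      by (simp only: sum_mset_parts of_nat_sum of_nat_mult)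
  qed
  also have "\<dots> = (\<Sum>k = 1..n. int k * part_count (k, b) n)"
    by (subst sum.swap) (simp add: part_count_def sum_distrib_left)
  also have "\<dots> = (\<Sum>k = 1..n. \<Sum>m | m \<in> {1..n} \<and> k dvd m. ?g m k * overpartition_fps $ (n - m))"
    by (intro sum.cong) (auto simp: part_count_eq sum_distrib_left mult.assoc)
  also have "\<dots> = (\<Sum>m = 1..n. \<Sum>k | k \<in> {1..n} \<and> k dvd m. ?g m k * overpartition_fps $ (n - m))"
    by (rule sum.swap_restrict) auto
  also have "\<dots> = (\<Sum>m = 1..n. ?s $ m * overpartition_fps $ (n - m))"
  proof (rule sum.cong[OF refl])
    fix m assume m: "m \<in> {1..n}"
    then have "{k. k \<in> {1..n} \<and> k dvd m} = {k. k dvd m}"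
      by (auto dest: dvd_imp_le intro!: Nat.gr0I simp: Suc_le_eq)
    then show "(\<Sum>k | k \<in> {1..n} \<and> k dvd m. ?g m k * overpartition_fps $ (n - m)) =
        ?s $ m * overpartition_fps $ (n - m)"
      using m signed_divisor_sum[of m b] by (simp flip: sum_distrib_right)
  qed
  also have "\<dots> = (\<Sum>m = 0..n. ?s $ m * overpartition_fps $ (n - m))"
    by (rule sum.mono_neutral_left) (auto simp: sigma_odd_fps_def sigma_fps_def Suc_le_eq)
  also have "\<dots> = (overpartition_fps * ?s) $ n"
    by (simp only: fps_mult_nth mult.commute[of overpartition_fps])
  finally show "Abs_fps (part_sum b) $ n = (overpartition_fps * ?s) $ n" by simp
qed

lemma nov_plus_ov: "int (nov n) + int (ov n) = int n * overpartition_fps $ n"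
proof -
  have "nov n + ov n = (\<Sum>M \<in> overpartitions n. sum_mset (image_mset fst M))"
    unfolding nov_def ov_def sum.distrib[symmetric]
  proof (rule sum.cong[OF refl])
    fix M :: "(nat \<times> bool) multiset"
    show "sum_mset (image_mset fst (filter_mset (\<lambda>p. \<not> snd p) M)) +
        sum_mset (image_mset fst (filter_mset (\<lambda>p. snd p) M)) = sum_mset (image_mset fst M)"
      by (induction M) auto
  qed
  also have "\<dots> = n * card (overpartitions n)"
    by (simp add: overpartitions_def)
  finally show ?thesis
    by (simp add: overpartition_fps_def flip: of_nat_add of_nat_mult)
qed

text \<open>\<open>D P\<close> is the sum of the two part-sum series, \<open>P (U + B)\<close>, and
  \<open>24 (U + B) = f - e\<close>.\<close>

lemma overpartition_fps_deriv:
  "24 * euler_deriv overpartition_fps = overpartition_fps * (level2_fps - e2_fps)"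
proof -
  have "euler_deriv overpartition_fps = Abs_fps (part_sum False) + Abs_fps (part_sum True)"
    by (rule fps_ext) (simp add: euler_deriv_nth nov_plus_ov part_sum_eq)
  then show ?thesis
    by (simp add: part_sum_fps level2_fps_def e2_fps_def algebra_simps)
qed

lemma overpartition_mult_level2_nth:
  "(overpartition_fps * level2_fps) $ n = overpartition_fps $ n + 24 * int (ov n)"
proof -
  have "overpartition_fps * level2_fps = overpartition_fps + 24 * Abs_fps (part_sum True)"
    by (simp add: part_sum_fps level2_fps_def algebra_simps)
  then show ?thesis by (simp add: numeral_mult_fps_nth part_sum_eq)
qed

lemma dvd_numeral_fps_nth:
  assumes "(numeral k :: int fps) dvd F"
  shows "numeral k dvd F $ n"
  using assms by (auto simp: numeral_mult_fps_nth elim!: dvdE)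

theorem theorem1p2:
  fixes n :: nat
  shows "[(int n + 2) * int (nov n) = (int n ^ 2 + 4 * int n + 3) * int (ov n)] (mod 5) \<and>
    [(int n ^ 2 + 1) * int (nov n) = (4 * int n ^ 3 - int n ^ 2 - 1) * int (ov n)] (mod 7)"
proof
  define p where "p = overpartition_fps $ n"
  have nov: "int (nov n) = int n * p - int (ov n)"
    using nov_plus_ov[of n] by (simp add: p_def)
  have "5 dvd 576 * (int n * (int n * (p + 24 * int (ov n)))) + 192 * (int n * p)"
    using dvd_numeral_fps_nth[OF level2_mod_5[OF overpartition_fps_deriv], of n]
    by (simp add: numeral_mult_fps_nth euler_deriv_nth overpartition_mult_level2_nth p_def)
  then obtain c where c: "576 * (int n * (int n * (p + 24 * int (ov n)))) + 192 * (int n * p) = 5 * c" ..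
  \<comment> \<open>The constants reduce \<open>c\<close> modulo 5:
    \<open>576 = 5 * 115 + 1\<close>, \<open>576 * 24 = 5 * 2765 - 1\<close> and
    \<open>192 = 5 * 38 + 2\<close>.\<close>
  have "(int n + 2) * int (nov n) - (int n ^ 2 + 4 * int n + 3) * int (ov n) =
      5 * (c - int n * (int n * (115 * p + 2765 * int (ov n))) - 38 * (int n * p)
        - (int n + 1) * int (ov n))"
    using c by (simp add: nov power2_eq_square algebra_simps)
  then show "[(int n + 2) * int (nov n) = (int n ^ 2 + 4 * int n + 3) * int (ov n)] (mod 5)"
    by (simp add: cong_iff_dvd_diff)
  have "7 dvd 13824 * (int n * (int n * (int n * (p + 24 * int (ov n)))) + int n * p)"
    using dvd_numeral_fps_nth[OF level2_mod_7[OF overpartition_fps_deriv], of n]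
    by (simp add: numeral_mult_fps_nth euler_deriv_nth overpartition_mult_level2_nth p_def)
  then obtain c where c: "13824 * (int n * (int n * (int n * (p + 24 * int (ov n)))) + int n * p) = 7 * c" ..
  \<comment> \<open>Here \<open>13824 = 7 * 1975 - 1\<close>, and the last term accounts for
    \<open>24 = 28 - 4\<close>.\<close>
  have "(int n ^ 2 + 1) * int (nov n) - (4 * int n ^ 3 - int n ^ 2 - 1) * int (ov n) =
      7 * (1975 * (int n * (int n * (int n * (p + 24 * int (ov n)))) + int n * p) - c
        - 4 * int n ^ 3 * int (ov n))"
    using c by (simp add: nov power2_eq_square power3_eq_cube algebra_simps)
  then show "[(int n ^ 2 + 1) * int (nov n) = (4 * int n ^ 3 - int n ^ 2 - 1) * int (ov n)] (mod 7)"
    by (simp add: cong_iff_dvd_diff)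
qed

end
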